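(* Let $\Lambda\subseteq[0,1)^d$ be a lattice with $\#\Lambda=N\ge3$. Then $\Lambda$ has a single distance vector if and only if $N$ is prime and, up to torus symmetry, the generating vector of $\Lambda$ is of the form $$\Big(\underbrace{\tfrac1N,\dots,\tfrac1N}_{m\text{ times}},\underbrace{\tfrac2N,\dots,\tfrac2N}_{m\text{ times}},\dots,\underbrace{\tfrac nN,\dots,\tfrac nN}_{m\text{ times}}\Big)$$ with $N=2n+1$ and $d=mn$ (with $m,n$ positive integers).
   Context: $\mathbb T=\mathbb R/\mathbb Z$ is identified with $[0,1)$. A lattice with $N$ points in $\mathbb T^d\simeq[0,1)^d$ is a set of the form $\left\{\left(\frac kN,\left\{\frac{h_2k}N\right\},\dots,\left\{\frac{h_dk}N\right\}\right):k=0,1,\dots,N-1\right\}$, where $\{\cdot\}$ is the fractional part and $h_2,\dots,h_d$ are integers with $\gcd(h_i,N)=1$ for all $i$; it is said to be generated by the generating vector $\left(\frac1N,\frac{h_2}N,\dots,\frac{h_d}N\right)$. Torus symmetries are translations, reflections of individual coordinates ($x_i\mapsto-x_i$) and permutations of the coordinates; "up to torus symmetry" means that some torus symmetry maps $\Lambda$ to the lattice generated by the displayed vector. Distance vector: for $x,y\in[0,1)$ let $\delta(x,y)=\min\{|x-y|,1-|x-y|\}$. For $\mathbf x,\mathbf y\in\mathbb T^d$, $\operatorname{dv}(\mathbf x,\mathbf y)$ is the vector of the numbers $\delta(x_1,y_1),\dots,\delta(x_d,y_d)$ sorted in increasing order. A set has a single distance vector if the set of all $\operatorname{dv}(\mathbf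 x,\mathbf y)$ over pairs of distinct points $\mathbf x\neq\mathbf y$ of it has exactly one element. *)

theory Defs
  imports Complex_Main "HOL-Computational_Algebra.Primes" "HOL-Combinatorics.Permutations"
begin

text \<open>
  A point of the \<open>d\<close>-dimensional torus is a list of length \<open>d\<close> with entries in \<open>[0,1)\<close>.
\<close>

text \<open>
  The list \<open>hs\<close> holds the integers \<open>h\<^sub>2, \<dots>, h\<^sub>d\<close>, so its length is \<open>d - 1\<close> and
  \<open>d \<ge> 1\<close> is implicit.
\<close>

definition lattice_generated_by :: "nat \<Rightarrow> real list \<Rightarrow> real list set \<Rightarrow> bool" where
  "lattice_generated_by N g \<Lambda> \<longleftrightarrow>
     N > 0 \<and>
     (\<exists>hs :: int list.
        (\<forall>h\<in>set hs. gcd h (int N) = 1) \<and>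
        g = (1 / real N) # map (\<lambda>h. of_int h / real N) hs \<and>
        \<Lambda> = {(real k / real N) # map (\<lambda>h. frac (of_int h * real k / real N)) hs | k. k < N})"

definition torus_lattice :: "nat \<Rightarrow> real list set \<Rightarrow> bool" where
  "torus_lattice d \<Lambda> \<longleftrightarrow> (\<exists>N g. length g = d \<and> lattice_generated_by N g \<Lambda>)"

text \<open>
  The torus symmetries are all compositions of the three basic kinds. The maps are
  only meaningful on points of the \<open>d\<close>-dimensional torus; \<open>frac\<close> reduces modulo 1.
\<close>

inductive torus_symmetry :: "nat \<Rightarrow> (real list \<Rightarrow> real list) \<Rightarrow> bool" for d :: nat where
  translation: "length t = d \<Longrightarrow> torus_symmetry d (\<lambda>x. map2 (\<lambda>a b. frac (a + b)) x t)"
| reflection: "i < d \<Longrightarrow> torus_symmetry d (\<lambda>x. x[i := frac (- (x ! i))])"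
| permutation: "p permutes {..<d} \<Longrightarrow> torus_symmetry d (permute_list p)"
| composition: "torus_symmetry d f \<Longrightarrow> torus_symmetry d g \<Longrightarrow> torus_symmetry d (f \<circ> g)"

definition torus_dist :: "real \<Rightarrow> real \<Rightarrow> real" where
  "torus_dist x y = min \<bar>x - y\<bar> (1 - \<bar>x - y\<bar>)"

definition distance_vector :: "real list \<Rightarrow> real list \<Rightarrow> real list" where
  "distance_vector x y = sort (map2 torus_dist x y)"

definition has_single_distance_vector :: "real list set \<Rightarrow> bool" where
  "has_single_distance_vector S \<longleftrightarrow>
     card {distance_vector x y | x y. x \<in> S \<and> y \<in> S \<and> x \<noteq> y} = 1"

definition block_vector :: "nat \<Rightarrow> nat \<Rightarrow> nat \<Rightarrow> real list" where
  "block_vector N m n = concat (map (\<lambda>j. replicate m (real j / real N)) [1..<n + 1])"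

end

theory Submission imports Defs
begin

text \<open>
  Differences of lattice points are again lattice points, so a lattice with coordinate multipliers
  \<open>h\<^sub>1 = 1, h\<^sub>2, \<dots>, h\<^sub>d\<close> has a single distance vector iff for every \<open>k\<close> not divisible by \<open>N\<close> the
  multiset of the distances of the \<open>k h\<^sub>i\<close> to \<open>N \<int>\<close> is the one for \<open>k = 1\<close>. A proper prime divisor
  \<open>k\<close> of \<open>N\<close> violates this, as \<open>1\<close> cannot be the distance of a multiple of \<open>k\<close>. For \<open>N\<close> prime,
  \<open>k h\<^sub>i\<close> has distance \<open>k\<close> iff \<open>h\<^sub>i\<close> has distance \<open>1\<close>, so all the distances \<open>1, \<dots>, n\<close> occur equally
  often; reflecting and permuting the coordinates then gives the block vector. Conversely,
  multiplication by \<open>k\<close> permutes the distances \<open>1, \<dots>, n\<close> when \<open>N\<close> is prime.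
\<close>

section \<open>Distance to the nearest multiple\<close>

text \<open>The two residues are the distances of \<open>a\<close> to the nearest multiples of
  \<open>N\<close> below and above; this symmetric form turns invariance under sign into
  commutativity of \<open>min\<close>.\<close>

definition nrm :: "nat \<Rightarrow> int \<Rightarrow> int" where
  "nrm N a = min (a mod int N) (- a mod int N)"

text \<open>Distance from \<open>x\<close> to the nearest integer. Unlike \<open>torus_dist\<close>,
  it needs no representatives in \<open>[0,1)\<close>.\<close>

definition tnorm :: "real \<Rightarrow> real" where
  "tnorm x = min (frac x) (frac (- x))"

lemma nrm_cases:
  assumes "N > 0"
  shows "int N dvd nrm N a - a \<or> int N dvd nrm N a + a"
proof -
  have "int N dvd a mod int N - a"
    by (simp add: mod_eq_dvd_iff[symmetric])
  moreover have "int N dvd (- a) mod int N - (- a)"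
    by (simp only: mod_eq_dvd_iff[symmetric] mod_mod_trivial)
  ultimately show ?thesis by (auto simp: nrm_def min_def)
qed

lemma nrm_bounds:
  assumes "N > 0"
  shows "0 \<le> nrm N a" "2 * nrm N a \<le> int N"
  using assms pos_mod_bound[of "int N" a]
  by (auto simp: nrm_def min_def zmod_zminus1_eq_if simp del: pos_mod_bound)

lemma nrm_eq_self:
  assumes "0 \<le> j" "2 * j < int N"
  shows "nrm N j = j"
proof (cases "j = 0")
  case False
  then have "(- j) mod int N = int N - j" "j mod int N = j"
    using assms by (auto simp: zmod_zminus1_eq_if)
  then show ?thesis using assms by (auto simp: nrm_def)
qed (simp add: nrm_def)

lemma nrm_uminus [simp]: "nrm N (- a) = nrm N a"
  by (simp add: nrm_def min.commute)

lemma nrm_cong: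
  assumes "int N dvd a - b"
  shows "nrm N a = nrm N b"
proof -
  have "a mod int N = b mod int N" using assms by (simp add: mod_eq_dvd_iff)
  moreover from this have "- a mod int N = - b mod int N" by (rule mod_minus_cong)
  ultimately show ?thesis by (simp add: nrm_def)
qed

text \<open>Each norm is congruent to its argument up to sign, so a common value can be eliminated
  between the two congruences.\<close>

lemma nrm_eq_iff:
  assumes "N > 0"
  shows "nrm N a = nrm N b \<longleftrightarrow> int N dvd a - b \<or> int N dvd a + b"
proof
  assume eq: "nrm N a = nrm N b"
  let ?r = "nrm N b"
  have a: "int N dvd ?r - a \<or> int N dvd ?r + a"
    using nrm_cases[OF assms, of a] eq by simp
  have b: "int N dvd ?r - b \<or> int N dvd ?r + b"
    by (rule nrm_cases[OF assms])
  \<comment> \<open>One identity for each of the four choices of signs in the two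
    congruences.\<close>
  have "a - b = (?r - b) - (?r - a)" "a - b = (?r + a) - (?r + b)"
    "a + b = (?r + b) - (?r - a)" "a + b = (?r + a) - (?r - b)" by simp_all
  then show "int N dvd a - b \<or> int N dvd a + b"
    using a b by (metis dvd_diff)
next
  assume "int N dvd a - b \<or> int N dvd a + b"
  then show "nrm N a = nrm N b"
    using nrm_cong[of N a b] nrm_cong[of N a "- b"] by auto
qed

lemma nrm_eq_0_iff:
  assumes "N > 0"
  shows "nrm N a = 0 \<longleftrightarrow> int N dvd a"
  using nrm_eq_iff[OF assms, of a 0] by (simp add: nrm_def)

section \<open>Circle distances in terms of integer residues\<close>

lemma frac_of_int_div: "frac (of_int a / real N) = of_int (a mod int N) / real N"
\<comment> \<open>For \<open>N = 0\<close> both quotients are 0 by the convention on division by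
  zero.\<close>
proof (cases "N = 0")
  case False
  have "\<lfloor>of_int a / real N\<rfloor> = a div int N"
    using floor_divide_of_int_eq[of a "int N"] by simp
  moreover have "real_of_int a = of_int (a div int N) * real N + of_int (a mod int N)"
    by (metis div_mult_mod_eq of_int_add of_int_mult of_int_of_nat_eq)
  ultimately show ?thesis using False by (simp add: frac_def field_simps)
qed simp

lemma tnorm_of_int_div: "tnorm (of_int a / real N) = of_int (nrm N a) / real N"
  using frac_of_int_div[of a N] frac_of_int_div[of "- a" N]
  by (auto simp: tnorm_def nrm_def min_def divide_right_mono divide_le_cancel)

lemma frac_diff_frac: "frac (frac x - frac y) = frac (x - y)"
proof -
  have "frac x - frac y = (x - y) + of_int (\<lfloor>y\<rfloor> - \<lfloor>x\<rfloor>)" by (simp add: frac_def)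
  then show ?thesis by (simp only: frac_add_of_int_right)
qed

lemma frac_minus_frac: "frac (- frac x) = frac (- x)"
  using frac_diff_frac[of 0 x] by simp

lemma tnorm_diff_frac: "tnorm (frac x - frac y) = tnorm (x - y)"
  using frac_diff_frac[of x y] frac_diff_frac[of y x] by (simp add: tnorm_def)

lemma tnorm_minus: "tnorm (x - y) = tnorm (y - x)"
  by (simp add: tnorm_def min.commute)

lemma torus_dist_eq_tnorm:
  assumes "x \<in> {0..<1}" "y \<in> {0..<1}"
  shows "torus_dist x y = tnorm (x - y)"
proof -
  have *: "torus_dist x y = tnorm (x - y)" if "y \<le> x" "x < 1" "0 \<le> y" for x y
  \<comment> \<open>Equality is split off because \<open>frac 0\<close> is 0, whereas
    \<open>1 + (y - x)\<close> would then be 1.\<close>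
  proof (cases "x = y")
    case False
    have "frac (x - y) = x - y" using that by (simp add: frac_eq)
    moreover have "frac (y - x) = 1 + (y - x)"
      using that False by (subst frac_unique_iff) auto
    ultimately show ?thesis using that by (simp add: torus_dist_def tnorm_def)
  qed (simp add: torus_dist_def tnorm_def)
  show ?thesis
  proof (cases "y \<le> x")
    case True then show ?thesis using * assms by simp
  next
    case False
    then have "torus_dist y x = tnorm (y - x)" using * assms by simp
    then show ?thesis by (simp add: torus_dist_def tnorm_minus abs_minus_commute)
  qed
qed

lemma torus_dist_frac: "torus_dist (frac x) (frac y) = tnorm (x - y)"
  by (subst torus_dist_eq_tnorm) (simp_all add: frac_lt_1 tnorm_diff_frac)

lemma torus_dist_eq_0_iff:
  assumes "x \<in> {0..<1}" "y \<in> {0..<1}"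
  shows "torus_dist x y = 0 \<longleftrightarrow> x = y"
  using assms by (auto simp: torus_dist_def min_def abs_if split: if_splits)

section \<open>Torus symmetries\<close>

definition torus :: "nat \<Rightarrow> real list set" where
  "torus d = {x. length x = d \<and> set x \<subseteq> {0..<1}}"

lemma sort_eq_iff_mset_eq: "sort xs = sort ys \<longleftrightarrow> mset xs = mset ys"
  by (metis mset_sort properties_for_sort sorted_sort)

lemma torus_nthD:
  assumes "x \<in> torus d" "i < d"
  shows "x ! i \<in> {0..<1}"
  using assms nth_mem[of i x] unfolding torus_def by blast

text \<open>Recovers equality of points from distances. The inclusion, in place of an equation with
  \<open>{0}\<close>, also covers the empty list at \<open>d = 0\<close>.\<close>

lemma distance_vector_eq_0_iff:
  assumes "x \<in> torus d" "y \<in> torus d"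
  shows "set (distance_vector x y) \<subseteq> {0} \<longleftrightarrow> x = y"
proof -
  have len: "length x = length y" using assms by (simp add: torus_def)
  have "torus_dist (x ! i) (y ! i) = 0 \<longleftrightarrow> x ! i = y ! i" if "i < length x" for i
    using that assms
    by (intro torus_dist_eq_0_iff torus_nthD[of _ d]) (simp_all add: torus_def)
  then show ?thesis using len
    by (auto simp: distance_vector_def set_zip list_eq_iff_nth_eq)
qed

text \<open>Translations and reflections preserve each coordinate distance; permutations reorder the
  distances, which sorting undoes. Membership in the torus is carried along so that the induction
  hypotheses chain in a composition.\<close>

lemma torus_symmetry_isometry:
  assumes "torus_symmetry d \<sigma>" "x \<in> torus d" "y \<in> torus d"
  shows "\<sigma> x \<in> torus d \<and> distance_vector (\<sigma> x) (\<sigma> y) = distance_vector x y"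
  using assms
proof (induction arbitrary: x y)
  case (translation t)
  have "torus_dist (frac (x ! i + t ! i)) (frac (y ! i + t ! i)) = torus_dist (x ! i) (y ! i)"
    if "i < d" for i
    using torus_nthD[OF translation(2) that] torus_nthD[OF translation(3) that]
    by (simp add: torus_dist_frac torus_dist_eq_tnorm)
  then have "map2 torus_dist (map2 (\<lambda>a b. frac (a + b)) x t) (map2 (\<lambda>a b. frac (a + b)) y t)
      = map2 torus_dist x y"
    using translation by (intro nth_equalityI) (auto simp: torus_def)
  then show ?case using translation
    by (auto simp: torus_def distance_vector_def frac_lt_1)
next
  case (reflection i)
  have len: "length x = d" "length y = d" using reflection by (auto simp: torus_def)
  have "torus_dist (frac (- (x ! i))) (frac (- (y ! i))) = torus_dist (x ! i) (y ! i)"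
    using torus_nthD[OF reflection(2,1)] torus_nthD[OF reflection(3,1)]
    by (simp add: torus_dist_frac torus_dist_eq_tnorm tnorm_minus)
  then have "map2 torus_dist (x[i := frac (- (x ! i))]) (y[i := frac (- (y ! i))])
      = map2 torus_dist x y"
    using len reflection(1) by (intro nth_equalityI) (auto simp: nth_list_update)
  moreover have "set (x[i := frac (- (x ! i))]) \<subseteq> insert (frac (- (x ! i))) (set x)"
    by (rule set_update_subset_insert)
  ultimately show ?case using reflection
    by (auto simp: torus_def distance_vector_def frac_lt_1)
next
  case (permutation p)
  then have len: "length x = d" "length y = d" by (auto simp: torus_def)
  have "map2 torus_dist (permute_list p x) (permute_list p y)
      = permute_list p (map2 torus_dist x y)"
    using permutation(1) len by (simp add: permute_list_zip[symmetric] permute_list_map)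
  then have "distance_vector (permute_list p x) (permute_list p y) = distance_vector x y"
    using permutation(1) len by (simp add: distance_vector_def sort_eq_iff_mset_eq)
  then show ?case using permutation len by (auto simp: torus_def)
next
  case (composition f g)
  then show ?case by (metis comp_apply)
qed

text \<open>An isometry is injective, since distance zero characterizes equality.\<close>

lemma torus_symmetry_eq_iff:
  assumes "torus_symmetry d \<sigma>" "x \<in> torus d" "y \<in> torus d"
  shows "\<sigma> x = \<sigma> y \<longleftrightarrow> x = y"
  using torus_symmetry_isometry[OF assms] torus_symmetry_isometry[OF assms(1,3,2)]
    distance_vector_eq_0_iff assms by metis

lemma has_single_distance_vector_image:
  assumes \<sigma>: "torus_symmetry d \<sigma>" and S: "S \<subseteq> torus d"
  shows "has_single_distance_vector (\<sigma> ` S) \<longleftrightarrow> has_single_distance_vector S"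
proof -
  have "{distance_vector x y | x y. x \<in> \<sigma> ` S \<and> y \<in> \<sigma> ` S \<and> x \<noteq> y}
      = {distance_vector (\<sigma> x) (\<sigma> y) | x y. x \<in> S \<and> y \<in> S \<and> \<sigma> x \<noteq> \<sigma> y}" by blast
  also have "\<dots> = {distance_vector x y | x y. x \<in> S \<and> y \<in> S \<and> x \<noteq> y}"
    using torus_symmetry_isometry[OF \<sigma>] torus_symmetry_eq_iff[OF \<sigma>] S
    by (intro Collect_cong ex_cong1) (metis subsetD)
  finally show ?thesis by (simp add: has_single_distance_vector_def)
qed

text \<open>Composes one reflection per index in \<open>S\<close>, so that the signs of any set of
  coordinates can be changed at once.\<close>

lemma torus_symmetry_reflections:
  assumes "finite S" "S \<subseteq> {..<d}"
  shows "\<exists>\<sigma>. torus_symmetry d \<sigma> \<and>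
    (\<forall>x. length x = d \<longrightarrow> \<sigma> x = map (\<lambda>i. if i \<in> S then frac (- (x ! i)) else x ! i) [0..<d])"
  using assms
proof (induction S rule: finite_induct)
  case empty
  \<comment> \<open>The identity is not among the generators by name; the trivial permutation
    supplies it.\<close>
  have "torus_symmetry d (permute_list id)"
    by (rule torus_symmetry.permutation) (rule permutes_id)
  moreover have "permute_list id x = map (\<lambda>i. x ! i) [0..<d]" if "length x = d" for x :: "real list"
    using that map_nth[of x] by simp
  ultimately show ?case
    by (intro exI[of _ "permute_list id"]) (simp del: permute_list_id)
next
  case (insert j S)
  then obtain \<sigma> where \<sigma>: "torus_symmetry d \<sigma>" and
    eq: "\<And>x. length x = d \<Longrightarrow> \<sigma> x = map (\<lambda>i. if i \<in> S then frac (- (x ! i)) else x ! i) [0..<d]"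
    by auto
  have j: "j < d" using insert by simp
  let ?\<rho> = "\<lambda>x::real list. x[j := frac (- (x ! j))]"
  have "torus_symmetry d (?\<rho> \<circ> \<sigma>)"
    by (intro torus_symmetry.composition torus_symmetry.reflection j \<sigma>)
  moreover have "(?\<rho> \<circ> \<sigma>) x
      = map (\<lambda>i. if i \<in> insert j S then frac (- (x ! i)) else x ! i) [0..<d]"
    if "length x = d" for x
    using insert(2) j that by (intro nth_equalityI) (auto simp: eq nth_list_update)
  ultimately show ?case by blast
qed

section \<open>Cyclic lattices\<close>

text \<open>The \<open>k\<close>-th multiple of the generating vector with numerators
  \<open>H\<close>. Letting \<open>k\<close> run over all integers makes differences of indices
  available as indices.\<close>

definition cyclic_point :: "nat \<Rightarrow> int list \<Rightarrow> int \<Rightarrow> real list" where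
  "cyclic_point N H k = map (\<lambda>h. frac (of_int (k * h) / real N)) H"

lemma cyclic_point_mod: "cyclic_point N H (k mod int N) = cyclic_point N H k"
  by (simp only: cyclic_point_def frac_of_int_div mod_mult_left_eq)

lemma cyclic_point_in_torus: "cyclic_point N H k \<in> torus (length H)"
  by (auto simp: cyclic_point_def torus_def frac_lt_1)

lemma range_cyclic_point:
  assumes "N > 0"
  shows "range (cyclic_point N H) = (\<lambda>k. cyclic_point N H (int k)) ` {..<N}"
proof -
  have "cyclic_point N H k \<in> (\<lambda>k. cyclic_point N H (int k)) ` {..<N}" for k
  proof (rule image_eqI[of _ _ "nat (k mod int N)"])
    show "cyclic_point N H k = cyclic_point N H (int (nat (k mod int N)))"
      using assms by (simp add: cyclic_point_mod)
    show "nat (k mod int N) \<in> {..<N}"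
      using assms by (simp add: nat_less_iff)
  qed
  then show ?thesis by blast
qed

text \<open>A coordinate with multiplier 1 determines \<open>k\<close> modulo \<open>N\<close>;
  conversely the point depends only on that residue.\<close>

lemma cyclic_point_eq_iff:
  assumes "N > 0" "1 \<in> set H"
  shows "cyclic_point N H k = cyclic_point N H l \<longleftrightarrow> int N dvd k - l"
proof
  assume "cyclic_point N H k = cyclic_point N H l"
  then have "frac (of_int (k * 1) / real N) = frac (of_int (l * 1) / real N)"
    using assms(2) unfolding cyclic_point_def map_eq_conv by blast
  then show "int N dvd k - l"
    using assms(1) by (simp only: frac_of_int_div) (simp add: mod_eq_dvd_iff[symmetric])
next
  assume "int N dvd k - l"
  then have "k mod int N = l mod int N" by (simp add: mod_eq_dvd_iff)
  then show "cyclic_point N H k = cyclic_point N H l" by (metis cyclic_point_mod)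
qed

lemma card_range_cyclic_point:
  assumes "N > 0" "1 \<in> set H"
  shows "card (range (cyclic_point N H)) = N"
proof -
  have "inj_on (\<lambda>k. cyclic_point N H (int k)) {..<N}"
  proof (rule inj_onI)
    fix x y assume xy: "x \<in> {..<N}" "y \<in> {..<N}"
      and "cyclic_point N H (int x) = cyclic_point N H (int y)"
    then have "int x mod int N = int y mod int N"
      using cyclic_point_eq_iff[OF assms] mod_eq_dvd_iff by blast
    with xy show "x = y" by simp
  qed
  then show ?thesis by (simp add: range_cyclic_point[OF assms(1)] card_image)
qed

text \<open>The separate first coordinate becomes the multiplier 1, because \<open>k / N\<close> is
  its own fractional part for \<open>k < N\<close>. All coordinates are then treated alike.\<close>

lemma lattice_generated_by_iff:
  "lattice_generated_by N g \<Lambda> \<longleftrightarrow> N > 0 \<and>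
    (\<exists>hs. (\<forall>h\<in>set (1 # hs). coprime h (int N)) \<and>
      g = map (\<lambda>h. of_int h / real N) (1 # hs) \<and> \<Lambda> = range (cyclic_point N (1 # hs)))"
proof -
  have "{(real k / real N) # map (\<lambda>h. frac (of_int h * real k / real N)) hs | k. k < N}
      = range (cyclic_point N (1 # hs))" if "N > 0" for hs
  proof -
    have "cyclic_point N (1 # hs) (int k)
        = (real k / real N) # map (\<lambda>h. frac (of_int h * real k / real N)) hs" if "k < N" for k
      using that by (auto simp: cyclic_point_def frac_eq mult.commute)
    then show ?thesis unfolding range_cyclic_point[OF that] by (auto simp: image_iff)
  qed
  then show ?thesis unfolding lattice_generated_by_def coprime_iff_gcd_eq_1
    by (intro conj_cong refl ex_cong1) auto
qed

section \<open>Single distance vectors as a condition on multipliers\<close>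

lemma distance_vector_cyclic_point:
  "distance_vector (cyclic_point N H k) (cyclic_point N H l)
    = sort (map (\<lambda>h. of_int (nrm N ((k - l) * h)) / real N) H)"
proof -
  have "torus_dist (frac (of_int (k * h) / real N)) (frac (of_int (l * h) / real N))
      = of_int (nrm N ((k - l) * h)) / real N" for h
    unfolding torus_dist_frac tnorm_of_int_div[symmetric]
    by (simp add: diff_divide_distrib left_diff_distrib)
  then show ?thesis
    by (simp add: distance_vector_def cyclic_point_def zip_map1 zip_map2 o_def
        zip_same_conv_map del: of_int_mult)
qed

text \<open>The distance vector of two points depends only on the difference of their indices, and
  distinct points are exactly those whose indices differ by a non-multiple of \<open>N\<close>.
  Constancy is tested against the index 1.\<close>

lemma single_distance_vector_cyclic_iff:
  assumes N: "N \<ge> 2" and H: "1 \<in> set H"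
  shows "has_single_distance_vector (range (cyclic_point N H)) \<longleftrightarrow>
    (\<forall>k. \<not> int N dvd k \<longrightarrow>
      image_mset (\<lambda>h. nrm N (k * h)) (mset H) = image_mset (nrm N) (mset H))"
proof -
  define v where "v k = sort (map (\<lambda>h. of_int (nrm N (k * h)) / real N) H)" for k
  let ?V = "{distance_vector x y | x y.
    x \<in> range (cyclic_point N H) \<and> y \<in> range (cyclic_point N H) \<and> x \<noteq> y}"
  have "N > 0" using N by simp
  note ne = cyclic_point_eq_iff[OF this H]
  have "?V = {v (k - l) | k l. \<not> int N dvd k - l}"
  proof -
    have "distance_vector (cyclic_point N H k) (cyclic_point N H l) = v (k - l)" for k l
      by (simp add: v_def distance_vector_cyclic_point)
    then show ?thesis using ne by (simp add: image_iff set_eq_iff) metis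
  qed
  also have "\<dots> = v ` {k. \<not> int N dvd k}" by (auto simp: image_iff) (metis diff_0_right)
  finally have V: "?V = v ` {k. \<not> int N dvd k}" .
  have 1: "1 \<in> {k. \<not> int N dvd k}" using N by auto
  have "has_single_distance_vector (range (cyclic_point N H)) \<longleftrightarrow>
      (\<exists>a. v ` {k. \<not> int N dvd k} = {a})"
    unfolding has_single_distance_vector_def V by (auto simp: card_1_singleton_iff)
  also have "\<dots> \<longleftrightarrow> (\<forall>k. \<not> int N dvd k \<longrightarrow> v k = v 1)"
  proof
    assume "\<exists>a. v ` {k. \<not> int N dvd k} = {a}"
    then obtain a where a: "v ` {k. \<not> int N dvd k} = {a}" by blast
    have "v k = a" if "\<not> int N dvd k" for k
      using imageI[of k "{k. \<not> int N dvd k}" v] that unfolding a by simp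
    then show "\<forall>k. \<not> int N dvd k \<longrightarrow> v k = v 1" using 1 by simp
  next
    assume "\<forall>k. \<not> int N dvd k \<longrightarrow> v k = v 1"
    then have "v ` {k. \<not> int N dvd k} = (\<lambda>_. v 1) ` {k. \<not> int N dvd k}"
      by (intro image_cong refl) simp
    also have "\<dots> = {v 1}" using 1 by (rule image_constant)
    finally show "\<exists>a. v ` {k. \<not> int N dvd k} = {a}" ..
  qed
  finally have "has_single_distance_vector (range (cyclic_point N H)) \<longleftrightarrow>
      (\<forall>k. \<not> int N dvd k \<longrightarrow> v k = v 1)" .
  moreover have v_eq: "v k = v 1 \<longleftrightarrow>
      image_mset (\<lambda>h. nrm N (k * h)) (mset H) = image_mset (nrm N) (mset H)" for k
  proof -
    \<comment> \<open>Division by \<open>N\<close> is injective, hence so is its action on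
      multisets: real distances may be replaced by their integer numerators.\<close>
    have "inj (\<lambda>a::int. of_int a / real N)" using N by (auto intro!: injI)
    then have "inj (image_mset (\<lambda>a::int. of_int a / real N))" by (rule multiset.inj_map)
    from inj_eq[OF this, of "image_mset (\<lambda>h. nrm N (k * h)) (mset H)" "image_mset (nrm N) (mset H)"]
    show ?thesis
      by (simp add: v_def sort_eq_iff_mset_eq multiset.map_comp o_def)
  qed
  ultimately show ?thesis by (simp only: v_eq)
qed

section \<open>Block vectors\<close>

definition blocks :: "nat \<Rightarrow> nat \<Rightarrow> int list" where
  "blocks m n = concat (map (\<lambda>j. replicate m (int j)) [1..<n + 1])"

lemma block_vector_eq: "block_vector N m n = map (\<lambda>h. of_int h / real N) (blocks m n)"
  by (simp add: block_vector_def blocks_def map_concat o_def)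

lemma repeat_mset_singleton: "repeat_mset m {#a#} = replicate_mset m a"
  by (rule multiset_eqI) simp

lemma mset_blocks: "mset (blocks m n) = repeat_mset m (mset_set {1..int n})"
proof (induction n)
  case (Suc n)
  have "{1..int (Suc n)} = insert (int (Suc n)) {1..int n}" by auto
  then show ?case using Suc by (simp add: blocks_def repeat_mset_singleton)
qed (simp add: blocks_def)

lemma image_mset_repeat_mset: "image_mset f (repeat_mset m M) = repeat_mset m (image_mset f M)"
  by (induction m) simp_all

lemma set_blocks: "set (blocks m n) = (if m = 0 then {} else {1..int n})"
proof -
  have "set_mset (repeat_mset m A) = (if m = 0 then {} else set_mset A)" for A :: "int multiset"
    by (induction m) auto
  then show ?thesis by (simp add: mset_blocks flip: set_mset_mset)
qed

lemma length_blocks: "length (blocks m n) = m * n"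
  by (simp add: mset_blocks flip: size_mset)

text \<open>Supplies the leading entry \<open>1 / N\<close> that a generating vector must
  have.\<close>

lemma blocks_Cons:
  assumes "m > 0" "n > 0"
  shows "blocks m n = 1 # tl (blocks m n)"
  using assms by (cases m) (simp_all add: blocks_def upt_conv_Cons del: upt_Suc)

text \<open>Twice the norm is at most the odd number \<open>2 * n + 1\<close>, so the norm is at
  most \<open>n\<close>; non-divisibility excludes 0.\<close>

lemma nrm_range:
  assumes "N = 2 * n + 1" "\<not> int N dvd a"
  shows "nrm N a \<in> {1..int n}"
  using nrm_bounds[of N a] nrm_eq_0_iff[of N a] assms by (auto simp: order_le_less)

text \<open>A prime \<open>N\<close> dividing \<open>k * (a - b)\<close> or
  \<open>k * (a + b)\<close> but not \<open>k\<close> divides the other factor.\<close>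

lemma nrm_mult_cancel:
  assumes "prime N" "\<not> int N dvd k"
  shows "nrm N (k * a) = nrm N (k * b) \<longleftrightarrow> nrm N a = nrm N b"
proof -
  have "N > 0" "prime (int N)" using assms by (simp_all add: prime_gt_0_nat)
  then show ?thesis using assms(2)
    by (simp add: nrm_eq_iff prime_dvd_mult_iff flip: right_diff_distrib distrib_left)
qed

lemma not_dvd_between:
  assumes "a \<in> {1..int n}" "N = 2 * n + 1"
  shows "\<not> int N dvd a"
  using assms zdvd_imp_le[of "int N" a] by auto

lemma single_distance_vector_blocks:
  assumes N: "prime N" "N = 2 * n + 1" and "m > 0" "n > 0"
  shows "has_single_distance_vector (range (cyclic_point N (blocks m n)))"
proof -
  have "image_mset (\<lambda>h. nrm N (k * h)) (mset (blocks m n)) = image_mset (nrm N) (mset (blocks m n))"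
    if k: "\<not> int N dvd k" for k
  proof -
    let ?A = "{1..int n}" and ?f = "\<lambda>h. nrm N (k * h)"
    have self: "nrm N a = a" if "a \<in> ?A" for a
      using that N by (intro nrm_eq_self) auto
    have inj: "inj_on ?f ?A"
      using self by (intro inj_onI) (auto simp: nrm_mult_cancel[OF N(1) k])
    have "?f a \<in> ?A" if "a \<in> ?A" for a
      using not_dvd_between[OF that N(2)] k N(1)
      by (intro nrm_range[OF N(2)]) (simp add: prime_dvd_mult_iff)
    \<comment> \<open>An injective map of a finite set into itself is onto. Thus \<open>?f\<close>
      permutes the distances, and all of them have the same multiplicity \<open>m\<close>.\<close>
    with inj have "?f ` ?A = ?A"
      by (intro endo_inj_surj) auto
    moreover have "image_mset (nrm N) (mset_set ?A) = mset_set ?A"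
      using self by (subst image_mset_cong[of _ _ "\<lambda>a. a"]) auto
    ultimately show ?thesis using inj
      by (simp add: mset_blocks image_mset_repeat_mset image_mset_mset_set)
  qed
  moreover have "1 \<in> set (blocks m n)" using assms by (simp add: set_blocks)
  ultimately show ?thesis using assms by (subst single_distance_vector_cyclic_iff) auto
qed

section \<open>Necessity: primality, equal multiplicities and the passage to blocks\<close>

lemma prime_of_single_distance_vector:
  assumes N: "N \<ge> 2" and H: "1 \<in> set H"
    and single: "has_single_distance_vector (range (cyclic_point N H))"
  shows "prime N"
proof (rule ccontr)
  assume "\<not> prime N"
  moreover obtain p where p: "prime p" "p dvd N" using N prime_factor_nat[of N] by auto
  ultimately have "p < N" using N dvd_imp_le[of p N] by (cases "p = N") auto
  then have "\<not> int N dvd int p" using p by (auto dest: dvd_imp_le simp: prime_gt_0_nat)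
  then have "image_mset (\<lambda>h. nrm N (int p * h)) (mset H) = image_mset (nrm N) (mset H)"
    using single single_distance_vector_cyclic_iff[OF N H] by blast
  \<comment> \<open>The multiplier 1 produces this distance at index 1, so it must also occur at
    index \<open>p\<close>.\<close>
  moreover have "nrm N 1 \<in># image_mset (nrm N) (mset H)" using H by simp
  ultimately have "nrm N 1 \<in># image_mset (\<lambda>h. nrm N (int p * h)) (mset H)" by metis
  then obtain h where "nrm N 1 = nrm N (int p * h)" by auto
  then have "int N dvd 1 - int p * h \<or> int N dvd 1 + int p * h"
    using N by (simp add: nrm_eq_iff)
  \<comment> \<open>Modulo the divisor \<open>p\<close> of \<open>N\<close> the term
    \<open>p * h\<close> vanishes, leaving 1.\<close>
  then have "int p dvd 1 - int p * h \<or> int p dvd 1 + int p * h"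
    using p(2) by (meson dvd_trans int_dvd_int_iff)
  then have "int p dvd 1"
    by (metis add_diff_cancel_right' diff_add_cancel dvd_add dvd_diff dvd_triv_left)
  then show False using p(1) by auto
qed

text \<open>Comparing index \<open>j\<close> with index 1 shows that distance \<open>j\<close> is as
  frequent as distance 1; no distance outside \<open>{1..n}\<close> occurs.\<close>

lemma mset_nrm_of_single_distance_vector:
  assumes N: "prime N" "N = 2 * n + 1" "n > 0"
    and H: "1 \<in> set H" "\<And>h. h \<in> set H \<Longrightarrow> \<not> int N dvd h"
    and single: "has_single_distance_vector (range (cyclic_point N H))"
  obtains m where "m > 0" "mset (map (nrm N) H) = mset (blocks m n)"
proof
  let ?M = "image_mset (nrm N) (mset H)"
  have nrm1: "nrm N 1 = 1" using N by (intro nrm_eq_self) auto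
  \<comment> \<open>The witness for \<open>m\<close> is the multiplicity of distance 1, positive
    because 1 is a multiplier.\<close>
  then show "count ?M 1 > 0"
    using H(1) by (metis count_greater_zero_iff image_eqI set_image_mset set_mset_mset)
  have count: "count ?M j = count ?M 1" if j: "j \<in> {1..int n}" for j
  proof -
    have nj: "\<not> int N dvd j" using not_dvd_between j N by blast
    have "N \<ge> 2" using N by simp
    then have M: "?M = image_mset (\<lambda>h. nrm N (j * h)) (mset H)"
      using single_distance_vector_cyclic_iff[OF _ H(1)] single nj by metis
    \<comment> \<open>Since \<open>j\<close> is the norm of \<open>j * 1\<close>, this is
      cancellation of \<open>j\<close>.\<close>
    have *: "nrm N (j * h) = j \<longleftrightarrow> nrm N h = 1" for h
    proof -
      have "nrm N (j * 1) = j" using j N by (simp add: nrm_eq_self)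
      then show ?thesis using nrm_mult_cancel[OF N(1) nj, of h 1] nrm1 by simp
    qed
    with M have "count ?M j = size {#h \<in># mset H. nrm N (j * h) = j#}"
      by (simp add: count_conv_size_mset filter_mset_image_mset)
    also have "\<dots> = size {#h \<in># mset H. nrm N h = 1#}"
      by (simp only: *)
    also have "\<dots> = count ?M 1"
      by (simp add: count_conv_size_mset filter_mset_image_mset)
    finally show ?thesis .
  qed
  have count_0: "count ?M j = 0" if "j \<notin> {1..int n}" for j
    using that nrm_range[OF N(2)] H(2) by (auto simp: count_eq_zero_iff)
  have "count ?M j = count (repeat_mset (count ?M 1) (mset_set {1..int n})) j" for j
    using count[of j] count_0[of j] by (cases "j \<in> {1..int n}") simp_all
  then show "mset (map (nrm N) H) = mset (blocks (count ?M 1) n)"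
    unfolding mset_map mset_blocks by (rule multiset_eqI)
qed

text \<open>Reflections replace each multiplier by its norm without changing the role of
  \<open>k\<close>; a permutation then arranges the norms in the order of \<open>B\<close>.\<close>

lemma torus_symmetry_cyclic:
  assumes "N > 0" and mset: "mset (map (nrm N) H) = mset B"
  obtains \<sigma> where "torus_symmetry (length H) \<sigma>"
    "\<sigma> ` range (cyclic_point N H) = range (cyclic_point N B)"
proof -
  let ?d = "length H"
  \<comment> \<open>The coordinates to reflect: there the norm is congruent to the negated
    multiplier.\<close>
  define S where "S = {i. i < ?d \<and> \<not> int N dvd nrm N (H ! i) - H ! i}"
  obtain \<rho> where \<rho>: "torus_symmetry ?d \<rho>" and
    eq: "\<And>x. length x = ?d \<Longrightarrow> \<rho> x = map (\<lambda>i. if i \<in> S then frac (- (x ! i)) else x ! i) [0..<?d]"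
    using torus_symmetry_reflections[of S ?d] by (auto simp: S_def)
  have frac_eqI: "frac (of_int (k * a) / real N) = frac (of_int (k * b) / real N)"
    if "int N dvd a - b" for a b k
  proof -
    have "int N dvd k * a - k * b" using that by (simp flip: right_diff_distrib)
    then show ?thesis by (simp only: frac_of_int_div mod_eq_dvd_iff[symmetric])
  qed
  have \<rho>_point: "\<rho> (cyclic_point N H k) = cyclic_point N (map (nrm N) H) k" for k
  proof (rule nth_equalityI)
    fix i assume "i < length (\<rho> (cyclic_point N H k))"
    then have i: "i < ?d" by (simp add: eq cyclic_point_def)
    show "\<rho> (cyclic_point N H k) ! i = cyclic_point N (map (nrm N) H) k ! i"
    proof (cases "i \<in> S")
      case True
      then have "int N dvd nrm N (H ! i) - (- (H ! i))"
        using nrm_cases[OF assms(1), of "H ! i"] by (simp add: S_def)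
      from frac_eqI[OF this, of k] show ?thesis
        using True i by (simp add: eq cyclic_point_def frac_minus_frac)
    next
      case False
      then have "int N dvd nrm N (H ! i) - H ! i" using i by (simp add: S_def)
      from frac_eqI[OF this, of k] show ?thesis
        using False i by (simp add: eq cyclic_point_def)
    qed
  qed (simp add: eq cyclic_point_def)
  obtain p where p: "p permutes {..<?d}" "permute_list p (map (nrm N) H) = B"
    using mset_eq_permutation[OF mset[symmetric]] by auto
  have "(permute_list p \<circ> \<rho>) (cyclic_point N H k) = cyclic_point N B k" for k
    using p permute_list_map[of p "map (nrm N) H"]
    unfolding comp_apply \<rho>_point unfolding cyclic_point_def by simp
  then have "(permute_list p \<circ> \<rho>) ` range (cyclic_point N H) = range (cyclic_point N B)"
    by (simp add: image_image)
  moreover have "torus_symmetry ?d (permute_list p \<circ> \<rho>)"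
    by (intro torus_symmetry.composition torus_symmetry.permutation p \<rho>)
  ultimately show ?thesis using that by blast
qed

theorem theorem2p8:
  fixes d N :: nat and \<Lambda> :: "real list set"
  assumes "torus_lattice d \<Lambda>"
    and "card \<Lambda> = N"
    and "N \<ge> 3"
  shows "has_single_distance_vector \<Lambda> \<longleftrightarrow>
    prime N \<and>
    (\<exists>m n :: nat. m > 0 \<and> n > 0 \<and> N = 2 * n + 1 \<and> d = m * n \<and>
      (\<exists>\<sigma>. torus_symmetry d \<sigma> \<and> lattice_generated_by N (block_vector N m n) (\<sigma> ` \<Lambda>)))"
    (is "_ \<longleftrightarrow> prime N \<and> ?R")
proof -
  obtain M g where g: "length g = d" "lattice_generated_by M g \<Lambda>"
    using assms(1) unfolding torus_lattice_def by blast
  then obtain hs where "M > 0" and cop: "\<And>h. h \<in> set (1 # hs) \<Longrightarrow> coprime h (int M)"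
    and d: "d = length (1 # hs)" and \<Lambda>: "\<Lambda> = range (cyclic_point M (1 # hs))"
    unfolding lattice_generated_by_iff by (metis length_map)
  define H where "H = 1 # hs"
  have H: "1 \<in> set H" by (simp add: H_def)
  \<comment> \<open>The lattice comes with its own denominator \<open>M\<close>, which its
    cardinality identifies.\<close>
  have "M = N" using assms(2) card_range_cyclic_point[OF \<open>M > 0\<close> H] by (simp add: \<Lambda> H_def)
  note cop = cop[unfolded this, folded H_def] and d = d[folded H_def]
    and \<Lambda> = \<Lambda>[unfolded this, folded H_def]
  show ?thesis
  proof
    assume single: "has_single_distance_vector \<Lambda>"
    have prime: "prime N"
      using prime_of_single_distance_vector[OF _ H] single assms(3) by (simp add: \<Lambda>)
    \<comment> \<open>The bound \<open>N \<ge> 3\<close> excludes the even prime.\<close>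
    then have "odd N" using assms(3) prime_odd_nat by simp
    then obtain n where n: "N = 2 * n + 1" by (elim oddE)
    then have "n > 0" using assms(3) by simp
    have "\<not> int N dvd h" if "h \<in> set H" for h
      using cop[OF that] assms(3) by (auto dest: coprime_common_divisor[of _ _ "int N"])
    then obtain m where "m > 0" and mset: "mset (map (nrm N) H) = mset (blocks m n)"
      using mset_nrm_of_single_distance_vector[OF prime n \<open>n > 0\<close> H] single by (auto simp: \<Lambda>)
    have "d = m * n"
      using arg_cong[OF mset, of size] by (simp add: d length_blocks)
    obtain \<sigma> where \<sigma>: "torus_symmetry d \<sigma>" "\<sigma> ` \<Lambda> = range (cyclic_point N (blocks m n))"
      using torus_symmetry_cyclic[OF _ mset] assms(3) by (auto simp: \<Lambda> d)
    \<comment> \<open>Block entries lie strictly between 0 and the prime \<open>N\<close>, so they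
      are admissible multipliers.\<close>
    have "coprime h (int N)" if "h \<in> set (blocks m n)" for h
      using that \<open>m > 0\<close> not_dvd_between[OF _ n, of h] prime
      by (auto simp: set_blocks coprime_commute[of h] intro!: prime_imp_coprime)
    then have "\<forall>h\<in>set (blocks m n). coprime h (int N)" by blast
    moreover obtain bs where "blocks m n = 1 # bs"
      using blocks_Cons[OF \<open>m > 0\<close> \<open>n > 0\<close>] by blast
    moreover have "N > 0" using assms(3) by simp
    ultimately have "lattice_generated_by N (block_vector N m n) (\<sigma> ` \<Lambda>)"
      unfolding lattice_generated_by_iff block_vector_eq \<sigma>(2) by metis
    then show "prime N \<and> ?R"
      using prime n \<open>n > 0\<close> \<open>m > 0\<close> \<open>d = m * n\<close> \<sigma>(1) by blast
  next
    assume "prime N \<and> ?R"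
    then obtain m n \<sigma> where prime: "prime N" and mn: "m > 0" "n > 0" "N = 2 * n + 1"
      and \<sigma>: "torus_symmetry d \<sigma>" "lattice_generated_by N (block_vector N m n) (\<sigma> ` \<Lambda>)" by blast
    then obtain hs' where hs': "block_vector N m n = map (\<lambda>h. of_int h / real N) (1 # hs')"
      and img: "\<sigma> ` \<Lambda> = range (cyclic_point N (1 # hs'))"
      unfolding lattice_generated_by_iff by blast
    \<comment> \<open>Injectivity recovers the multipliers from the generating vector, so the image
      of the lattice under \<open>\<sigma>\<close> is the cyclic lattice of
      \<open>blocks m n\<close>.\<close>
    have "inj (\<lambda>h::int. of_int h / real N)" using assms(3) by (auto intro!: injI)
    then have "blocks m n = 1 # hs'"
      using hs' inj_map_eq_map unfolding block_vector_eq by blast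
    then have "has_single_distance_vector (\<sigma> ` \<Lambda>)"
      using single_distance_vector_blocks[OF prime mn(3,1,2)] by (simp add: img)
    moreover have "\<Lambda> \<subseteq> torus d" using cyclic_point_in_torus by (auto simp: \<Lambda> d)
    ultimately show "has_single_distance_vector \<Lambda>"
      using has_single_distance_vector_image[OF \<sigma>(1)] by simp
  qed
qed

end
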